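(* Let $G$ and $H$ be connected finite graphs with $|V(G)|=|V(H)|\geq 2$. Then $$h^+_H(G)\leq h^+_{H}(P_{|V(G)|-1}).$$ Moreover, equality holds if and only if $G$ is a path (i.e. $G$ is isomorphic to $P_{|V(G)|-1}$).
   Context: All graphs are finite, simple and undirected. $P_{n-1}$ denotes the path of length $n-1$ (so it has $n$ vertices). For a connected graph $G$, $\rho_G(x,y)$ denotes the graph distance of vertices $x,y$ in $G$. Given graphs $G,H$ with $|V(G)|=|V(H)|$, a pseudoordering on $G$ by $H$ is a bijection $f:V(H)\to V(G)$, and its sum is $$s_H(f,G)=\sum_{\{x,y\}\in E(H)}\rho_G(f(x),f(y)).$$ The upper $H$-Hamiltonian number of $G$ is $h_H^+(G)=\max\{s_H(f,G)\mid f \text{ a pseudoordering on } G \text{ by } H\}$. *)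

theory Defs
  imports "Graph_Theory.Graph_Theory"
begin

text \<open>A finite simple undirected graph is a \<^locale>\<open>pair_graph\<close>: a finite digraph without
  loops and parallel arcs whose arc relation is symmetric. An undirected edge {x, y} thus
  corresponds to the two arcs (x, y) and (y, x), and is counted once in \<open>edges\<close>.\<close>

definition edges :: "'a pair_pre_digraph \<Rightarrow> 'a set set" where
  "edges G = {{x, y} | x y. (x, y) \<in> parcs G}"

definition graph_dist :: "'a pair_pre_digraph \<Rightarrow> 'a \<Rightarrow> 'a \<Rightarrow> nat" where
  "graph_dist G x y = (LEAST k. \<exists>p. pre_digraph.awalk (with_proj G) x p y \<and> length p = k)"

text \<open>The distance of the two vertices of an unordered pair; it is well defined because
  \<open>graph_dist\<close> is symmetric, see \<open>pair_dist_doubleton\<close> below.\<close>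

definition pair_dist :: "'a pair_pre_digraph \<Rightarrow> 'a set \<Rightarrow> nat" where
  "pair_dist G e = (THE d. \<exists>x y. e = {x, y} \<and> d = graph_dist G x y)"

definition pseudoordering :: "'b pair_pre_digraph \<Rightarrow> 'a pair_pre_digraph \<Rightarrow> ('b \<Rightarrow> 'a) \<Rightarrow> bool" where
  "pseudoordering H G f \<longleftrightarrow> bij_betw f (pverts H) (pverts G)"

definition pseudo_sum :: "'b pair_pre_digraph \<Rightarrow> ('b \<Rightarrow> 'a) \<Rightarrow> 'a pair_pre_digraph \<Rightarrow> nat" where
  "pseudo_sum H f G = (\<Sum>e\<in>edges H. pair_dist G (f ` e))"

definition upper_hamiltonian :: "'b pair_pre_digraph \<Rightarrow> 'a pair_pre_digraph \<Rightarrow> nat" where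
  "upper_hamiltonian H G = Max {pseudo_sum H f G | f. pseudoordering H G f}"

text \<open>The path of length \<open>n\<close>, that is, with \<open>n\<close> edges and \<open>n + 1\<close> vertices.\<close>

definition path_graph :: "nat \<Rightarrow> nat pair_pre_digraph" where
  "path_graph n = \<lparr> pverts = {0..n},
     parcs = {(i, j). i \<le> n \<and> j \<le> n \<and> (j = Suc i \<or> i = Suc j)} \<rparr>"

lemma pair_graph_path_graph: "pair_graph (path_graph n)"
proof
  have "parcs (path_graph n) \<subseteq> {0..n} \<times> {0..n}"
    by (auto simp: path_graph_def)
  then show "finite (parcs (path_graph n))"
    by (rule finite_subset) simp
  show "symmetric (with_proj (path_graph n))"
    by (auto simp: symmetric_def path_graph_def sym_def)
qed (auto simp: path_graph_def)

context pair_sym_digraph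
begin

lemma awalk_reverse:
  assumes "awalk x p y"
  shows "\<exists>q. awalk y q x \<and> length q = length p"
  using assms
proof (induction p arbitrary: x)
  case Nil
  then show ?case by (intro exI[of _ "[]"]) (auto simp: awalk_def)
next
  case (Cons e p)
  then have e: "e \<in> parcs G" "fst e = x" and "awalk (snd e) p y"
    by (auto simp: awalk_Cons_iff)
  then obtain q where q: "awalk y q (snd e)" "length q = length p"
    using Cons.IH by blast
  have "(snd e, fst e) \<in> parcs G"
    using e pair_sym_arcs by (auto simp: symmetric_def sym_def) 
  then have "awalk (snd e) [(snd e, fst e)] x"
    using e by (auto simp: awalk_def wellformed')
  with q have "awalk y (q @ [(snd e, fst e)]) x"
    by (auto intro: awalk_appendI)
  with q(2) show ?case by (intro exI[of _ "q @ [(snd e, fst e)]"]) simp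
qed

lemma graph_dist_commute: "graph_dist G x y = graph_dist G y x"
proof -
  have "(\<exists>p. awalk x p y \<and> length p = k) \<longleftrightarrow> (\<exists>p. awalk y p x \<and> length p = k)" for k
    using awalk_reverse by metis
  then show ?thesis by (simp add: graph_dist_def)
qed

lemma pair_dist_doubleton: "pair_dist G {x, y} = graph_dist G x y"
  unfolding pair_dist_def
  by (rule the_equality) (auto simp: doubleton_eq_iff graph_dist_commute)

end

end

theory Submission
  imports Defs
begin

text \<open>Pulling the arcs of \<open>G\<close> back along a pseudoordering turns \<open>G\<close> into a second connected graph
\<open>R\<close> on the vertex set \<open>V\<close> of \<open>H\<close>. The sum of the pseudoordering is then, up to a factor 2
because every edge is two arcs, the sum \<open>total_dist D R\<close> of the \<open>R\<close>-distances over the arcs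
\<open>D\<close> of \<open>H\<close>. Everything follows from one statement about connected graphs on \<open>V\<close>: a graph \<open>R\<close>
that maximises \<open>total_dist D R\<close> is a path (\<open>maximal_imp_linear\<close>). Since there are
finitely many graphs on \<open>V\<close>, maximisers exist, so some path is at least as good as \<open>R\<close>, and \<open>R\<close>
is as good as a best path only if it is a path itself (\<open>ex_linear_dominating\<close>).

So let \<open>R\<close> be a maximiser. Deleting edges does not shorten distances; hence every connected
spanning subgraph of \<open>R\<close> is also a maximiser, and it has the same distances along \<open>D\<close>.

A vertex \<open>v\<close> of \<open>R\<close> has at most two neighbours. If it had three, delete edges until \<open>V - {v}\<close>
falls into three branches \<open>A\<close>, \<open>B\<close>, \<open>C\<close> that are joined only through \<open>v\<close>, with neighbours
\<open>a\<close>, \<open>b\<close>, \<open>c\<close> of \<open>v\<close> in them. Detach \<open>A\<close> from \<open>v\<close> and hang it on \<open>b\<close> instead: the distances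
between \<open>A\<close> and \<open>B\<close> drop by at most 1, those from \<open>A\<close> to \<open>C\<close> and to \<open>v\<close> grow by 1, and the others do
not drop. Over the three rotated moves (\<open>A\<close> to \<open>b\<close>, \<open>B\<close> to \<open>c\<close>, \<open>C\<close> to \<open>a\<close>) the
losses between two branches are compensated by the gains, while the distances from \<open>v\<close> gain in
total. As \<open>v\<close> has a \<open>D\<close>-neighbour, one of the moves increases \<open>total_dist D\<close>, a contradiction.

Hence \<open>R\<close> is a path or a cycle. A cycle with \<open>n\<close> vertices contains \<open>n\<close> spanning paths, all of which
give the same distances along \<open>D\<close>. For two \<open>D\<close>-neighbours that cut the cycle into arcs of length \<open>k\<close> and
\<open>n - k\<close>, both of these lengths occur among those distances, so \<open>2 * k = n\<close>: each vertex has only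
its antipode as a \<open>D\<close>-neighbour, and \<open>D\<close> is not connected because \<open>n \<ge> 3\<close>.\<close>

section \<open>Distances in connected graphs\<close>

definition step_dist :: "('a \<times> 'a) set \<Rightarrow> 'a \<Rightarrow> 'a \<Rightarrow> nat" where
  "step_dist R x y = (LEAST k. (x, y) \<in> R ^^ k)"

lemma step_dist_le: "(x, y) \<in> R ^^ k \<Longrightarrow> step_dist R x y \<le> k"
  unfolding step_dist_def by (rule Least_le)

lemma relpow_step_dist: "(x, y) \<in> R\<^sup>* \<Longrightarrow> (x, y) \<in> R ^^ step_dist R x y"
  unfolding step_dist_def by (meson LeastI_ex rtrancl_imp_relpow)

text \<open>Distances in paths and in graphs with a reattached branch are bounded from below by exhibiting a function on the
vertices that grows by at most 1 along each arc.\<close>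

lemma potential_le_relpow:
  fixes \<phi> :: "'a \<Rightarrow> nat"
  assumes "\<And>u w. (u, w) \<in> R \<Longrightarrow> \<phi> w \<le> \<phi> u + 1" and "(x, y) \<in> R ^^ k"
  shows "\<phi> y \<le> \<phi> x + k"
  using assms(2)
proof (induction k arbitrary: y)
  case (Suc k)
  then obtain w where "(x, w) \<in> R ^^ k" "(w, y) \<in> R" by auto
  with Suc.IH[of w] assms(1)[of w y] show ?case by linarith
qed auto

locale conn_graph =
  fixes V :: "'a set" and R :: "('a \<times> 'a) set"
  assumes finite_V: "finite V"
    and R_sub: "R \<subseteq> V \<times> V"
    and R_sym: "(x, y) \<in> R \<Longrightarrow> (y, x) \<in> R"
    and R_irrefl: "(x, x) \<notin> R"
    and R_conn: "x \<in> V \<Longrightarrow> y \<in> V \<Longrightarrow> (x, y) \<in> R\<^sup>*"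
begin

abbreviation d :: "'a \<Rightarrow> 'a \<Rightarrow> nat" where "d \<equiv> step_dist R"

lemma edge_V: "(x, y) \<in> R \<Longrightarrow> x \<in> V \<and> y \<in> V"
  using R_sub by auto

lemma d_attained: "x \<in> V \<Longrightarrow> y \<in> V \<Longrightarrow> (x, y) \<in> R ^^ d x y"
  by (rule relpow_step_dist[OF R_conn])

lemma d_self [simp]: "d x x = 0"
  using step_dist_le[of x x 0 R] by simp

lemma d_eq_0: "x \<in> V \<Longrightarrow> y \<in> V \<Longrightarrow> d x y = 0 \<longleftrightarrow> x = y"
  using d_attained[of x y] by auto

lemma d_triangle: "x \<in> V \<Longrightarrow> y \<in> V \<Longrightarrow> z \<in> V \<Longrightarrow> d x z \<le> d x y + d y z"
  by (rule step_dist_le, rule relpow_trans[OF d_attained d_attained])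

lemma d_edge: "(x, y) \<in> R \<Longrightarrow> d x y = 1"
  using step_dist_le[of x y 1 R] d_eq_0[of x y] edge_V[of x y] R_irrefl[of x]
  by (cases "d x y") (auto simp: relpow_1)

lemma d_edge_le: "x \<in> V \<Longrightarrow> (u, w) \<in> R \<Longrightarrow> d x w \<le> d x u + 1"
  using d_triangle[of x u w] edge_V[of u w] d_edge[of u w] by auto

lemma d_ge_potential:
  fixes \<phi> :: "'a \<Rightarrow> nat"
  assumes "\<And>u w. (u, w) \<in> R \<Longrightarrow> \<phi> w \<le> \<phi> u + 1" and "x \<in> V" "y \<in> V"
  shows "\<phi> y \<le> \<phi> x + d x y"
  using potential_le_relpow[OF assms(1) d_attained[OF assms(2,3)]] .

lemma d_commute: "x \<in> V \<Longrightarrow> y \<in> V \<Longrightarrow> d x y = d y x"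
proof -
  have le: "d x y \<le> d y x" if "x \<in> V" "y \<in> V" for x y
  proof -
    have "d x y \<le> d y y + d y x"
    proof (rule d_ge_potential)
      show "d w y \<le> d u y + 1" if "(u, w) \<in> R" for u w
        using d_triangle[of w u y] d_edge[OF R_sym[OF that]] edge_V[OF that] \<open>y \<in> V\<close> by simp
    qed (use that in auto)
    then show ?thesis by simp
  qed
  then show "x \<in> V \<Longrightarrow> y \<in> V \<Longrightarrow> d x y = d y x" by (simp add: le_antisym)
qed

lemma predecessor:
  assumes "x \<in> V" "y \<in> V" "d x y = Suc k"
  obtains p where "(p, y) \<in> R" "d x p = k"
proof -
  from d_attained[OF assms(1,2)] assms(3) obtain p where p: "(x, p) \<in> R ^^ k" "(p, y) \<in> R"
    by auto
  then have "d x p = k"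
    using step_dist_le[OF p(1)] d_edge_le[OF assms(1) p(2)] assms(3) by linarith
  with p(2) that show ?thesis by blast
qed

end

lemma conn_graphI:
  assumes "finite V" "R \<subseteq> V \<times> V" "\<And>x y. (x, y) \<in> R \<Longrightarrow> (y, x) \<in> R" "\<And>x. (x, x) \<notin> R"
    and "\<And>x. x \<in> V \<Longrightarrow> (v, x) \<in> R\<^sup>*"
  shows "conn_graph V R"
proof
  have "sym (R\<^sup>*)" using assms(3) by (intro sym_rtrancl symI)
  then show "(x, y) \<in> R\<^sup>*" if "x \<in> V" "y \<in> V" for x y
    using assms(5)[OF that(1)] assms(5)[OF that(2)] by (meson rtrancl_trans symD)
qed (use assms in auto)

section \<open>Total distance along the arcs of a second graph\<close>

definition total_dist :: "('a \<times> 'a) set \<Rightarrow> ('a \<times> 'a) set \<Rightarrow> nat" where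
  "total_dist D R = (\<Sum>(x, y)\<in>D. step_dist R x y)"

lemma step_dist_antimono:
  assumes "conn_graph V R" "R \<subseteq> R'" "x \<in> V" "y \<in> V"
  shows "step_dist R' x y \<le> step_dist R x y"
proof -
  interpret conn_graph V R by fact
  show ?thesis
    using d_attained[OF assms(3,4)] assms(2)
    by (intro step_dist_le) (force simp: relpow_fun_conv)
qed

lemma total_dist_antimono:
  assumes "conn_graph V R" "R \<subseteq> R'" "D \<subseteq> V \<times> V"
  shows "total_dist D R' \<le> total_dist D R"
  unfolding total_dist_def
  by (rule sum_mono) (use assms step_dist_antimono[OF assms(1,2)] in auto)

context conn_graph
begin

section \<open>Reattaching a branch\<close>

definition branch :: "'a \<Rightarrow> 'a set \<Rightarrow> bool" where
  "branch v A \<longleftrightarrow> A \<subseteq> V \<and> v \<notin> A \<and> (\<forall>x\<in>A. \<forall>y. (x, y) \<in> R \<longrightarrow> y \<in> A \<or> y = v)"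

text \<open>The edges between \<open>A\<close> and \<open>v\<close> become edges between \<open>A\<close> and \<open>b\<close>.\<close>

definition reattach :: "'a \<Rightarrow> 'a set \<Rightarrow> 'a \<Rightarrow> ('a \<times> 'a) set" where
  "reattach v A b = {(x, y) \<in> R. \<not> (x \<in> A \<and> y = v) \<and> \<not> (x = v \<and> y \<in> A)}
     \<union> {(a, b) | a. a \<in> A \<and> (a, v) \<in> R} \<union> {(b, a) | a. a \<in> A \<and> (a, v) \<in> R}"

lemma conn_graph_reattach:
  assumes "branch v A" "(b, v) \<in> R" "b \<notin> A"
  shows "conn_graph V (reattach v A b)"
proof (rule conn_graphI)
  have vV: "v \<in> V" "b \<in> V" using edge_V[OF assms(2)] by auto
  show "finite V" by (rule finite_V)
  show "reattach v A b \<subseteq> V \<times> V" using vV edge_V by (auto simp: reattach_def)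
  show sym: "(y, x) \<in> reattach v A b" if "(x, y) \<in> reattach v A b" for x y
    using that R_sym by (auto simp: reattach_def)
  show "(x, x) \<notin> reattach v A b" for x
    using R_irrefl assms(3) by (auto simp: reattach_def)
  have bv: "(b, v) \<in> reattach v A b" using assms by (auto simp: reattach_def branch_def)
  have key: "(x, v) \<in> (reattach v A b)\<^sup>*" if "x \<in> A" "(x, v) \<in> R" for x
    using bv that by (intro rtrancl_into_rtrancl[OF r_into_rtrancl bv]) (auto simp: reattach_def)
  have "sym ((reattach v A b)\<^sup>*)" using sym by (intro sym_rtrancl symI)
  have "(x, y) \<in> (reattach v A b)\<^sup>*" if xy: "(x, y) \<in> R" for x y
  proof -
    consider "x \<in> A" "y = v" | "y \<in> A" "x = v" | "(x, y) \<in> reattach v A b"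
      using xy by (auto simp: reattach_def)
    then show ?thesis
    proof cases
      case 1
      then show ?thesis using key xy by blast
    next
      case 2
      then show ?thesis using key[of y] R_sym[OF xy] symD[OF \<open>sym ((reattach v A b)\<^sup>*)\<close>] by blast
    qed blast
  qed
  then have "R \<subseteq> (reattach v A b)\<^sup>*" by auto
  then have "R\<^sup>* \<subseteq> (reattach v A b)\<^sup>*" by (metis rtrancl_idemp rtrancl_mono)
  then show "(v, x) \<in> (reattach v A b)\<^sup>*" if "x \<in> V" for x
    using R_conn[OF vV(1) that] by auto
qed

text \<open>A walk from \<open>b\<close> leaves its branch through \<open>v\<close> only.\<close>

lemma d_across_branch:
  assumes "branch v B" "b \<in> B" "(b, v) \<in> R" "y \<in> V" "y \<notin> B"
  shows "d b y = 1 + d v y"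
proof -
  have V: "b \<in> V" "v \<in> V" using edge_V[OF assms(3)] by auto
  let ?\<phi> = "\<lambda>u. if u \<in> B then d b u else 1 + d v u"
  have "?\<phi> y \<le> ?\<phi> b + d b y"
  proof (rule d_ge_potential)
    fix u w assume uw: "(u, w) \<in> R"
    have "u = v" if "u \<notin> B" "w \<in> B" using assms(1) that R_sym[OF uw] by (auto simp: branch_def)
    moreover have "w = v" if "w \<notin> B" "u \<in> B" using assms(1) that uw by (auto simp: branch_def)
    ultimately show "?\<phi> w \<le> ?\<phi> u + 1"
      using d_edge_le[OF V(1) uw] d_edge_le[OF V(2) uw] d_edge[OF assms(3)] by auto
  qed (use V assms in auto)
  then have "1 + d v y \<le> d b y" using assms by simp
  then show ?thesis
    using d_triangle[OF V assms(4)] d_edge[OF assms(3)] by simp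
qed

text \<open>A shortest walk from \<open>x\<close> in \<open>A\<close> out of \<open>A\<close> has to pass through \<open>b\<close> after the move, where it passed
through \<open>v\<close> before. Thus its distance to a vertex \<open>y\<close> outside \<open>A\<close> changes by \<open>d b y - d v y\<close>, which is 1 for \<open>y\<close>
outside \<open>B\<close> and at least \<open>-1\<close> for \<open>y\<close> in \<open>B\<close>.\<close>

lemma d_reattach_ge:
  assumes A: "branch v A" and B: "branch v B" and AB: "A \<inter> B = {}"
    and b: "b \<in> B" "(b, v) \<in> R" and V: "x \<in> V" "y \<in> V"
  shows "int (d x y) + (if (x \<in> A) = (y \<in> A) then 0 else if x \<in> B \<or> y \<in> B then - 1 else 1)
    \<le> int (step_dist (reattach v A b) x y)"
proof -
  have bA: "b \<notin> A" "v \<notin> A" using AB b A by (auto simp: branch_def)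
  have vV: "v \<in> V" "b \<in> V" using edge_V[OF b(2)] by auto
  interpret R': conn_graph V "reattach v A b"
    by (rule conn_graph_reattach[OF A b(2) bA(1)])
  have edgeD: "(u \<in> A \<longleftrightarrow> w \<in> A) \<and> (u, w) \<in> R \<or> u \<in> A \<and> w = b \<and> (u, v) \<in> R
      \<or> u = b \<and> w \<in> A \<and> (v, w) \<in> R"
    if "(u, w) \<in> reattach v A b" for u w
    using that A bA R_sym[of u w] R_sym[of w u] R_sym[of w v] by (auto simp: reattach_def branch_def)
  have cross: "int (d x y) + (if y \<in> B then - 1 else 1) \<le> int (R'.d x y)"
    if xy: "x \<in> A" "y \<notin> A" "x \<in> V" "y \<in> V" for x y
  proof -
    \<comment> \<open>The potential is the distance from \<open>x\<close> in the new graph: out of \<open>A\<close> it counts the walk to \<open>b\<close>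
      as long as the old walk to \<open>v\<close>.\<close>
    let ?\<phi> = "\<lambda>u. if u \<in> A then d x u else d x v + d b u"
    have "?\<phi> y \<le> ?\<phi> x + R'.d x y"
    proof (rule R'.d_ge_potential)
      fix u w assume uw: "(u, w) \<in> reattach v A b"
      from edgeD[OF uw] show "?\<phi> w \<le> ?\<phi> u + 1"
        using d_edge_le[OF \<open>x \<in> V\<close>, of u w] d_edge_le[OF \<open>b \<in> V\<close>, of u w]
          d_edge_le[OF \<open>x \<in> V\<close>, of u v] d_edge_le[OF \<open>x \<in> V\<close>, of v w] bA
        by auto
    qed (use xy in auto)
    then have *: "d x v + d b y \<le> R'.d x y" using xy by simp
    have xvy: "d x y \<le> d x v + d v y" using d_triangle xy vV by blast
    show ?thesis
    proof (cases "y \<in> B")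
      case True
      have "d v y \<le> 1 + d b y"
        using d_triangle[of v b y] d_edge[OF R_sym[OF b(2)]] vV xy by simp
      with True * xvy show ?thesis by simp
    next
      case False
      with d_across_branch[OF B b xy(4) False] * xvy show ?thesis by simp
    qed
  qed
  have same: "d x y \<le> R'.d x y" if xy: "x \<in> A \<longleftrightarrow> y \<in> A"
  proof (cases "x \<in> A")
    case True
    let ?\<phi> = "\<lambda>u. if u \<in> A then d x u else d x v + d b u"
    have "?\<phi> y \<le> ?\<phi> x + R'.d x y"
    proof (rule R'.d_ge_potential)
      fix u w assume uw: "(u, w) \<in> reattach v A b"
      from edgeD[OF uw] show "?\<phi> w \<le> ?\<phi> u + 1"
        using d_edge_le[OF \<open>x \<in> V\<close>, of u w] d_edge_le[OF \<open>b \<in> V\<close>, of u w]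
          d_edge_le[OF \<open>x \<in> V\<close>, of u v] d_edge_le[OF \<open>x \<in> V\<close>, of v w] bA
        by auto
    qed (use V in auto)
    with True xy show ?thesis by simp
  next
    case False
    let ?\<phi> = "\<lambda>u. if u \<in> A then d x b + d v u else d x u"
    have "?\<phi> y \<le> ?\<phi> x + R'.d x y"
    proof (rule R'.d_ge_potential)
      fix u w assume uw: "(u, w) \<in> reattach v A b"
      from edgeD[OF uw] show "?\<phi> w \<le> ?\<phi> u + 1"
        using d_edge_le[OF \<open>x \<in> V\<close>, of u w] d_edge_le[OF \<open>v \<in> V\<close>, of u w]
          d_edge[of v w] bA
        by auto
    qed (use V in auto)
    with False xy show ?thesis by simp
  qed
  show ?thesis
  proof (cases "x \<in> A \<longleftrightarrow> y \<in> A")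
    case True
    then show ?thesis using same by simp
  next
    case False
    then consider "x \<in> A" "y \<notin> A" | "y \<in> A" "x \<notin> A" by blast
    then show ?thesis
    proof cases
      case 1
      then show ?thesis using cross[OF 1 V] AB by auto
    next
      case 2
      then show ?thesis
        using cross[OF 2 V(2,1)] AB d_commute[OF V] R'.d_commute[OF V] by auto
    qed
  qed
qed

end

context conn_graph
begin

text \<open>A pair of vertices in two different branches is lengthened by one of the three moves, shortened by at most 1 by
another one, and not shortened by the third. A pair consisting of \<open>v\<close> and a vertex of a branch is lengthened when
that branch moves and not shortened otherwise; such a pair is in \<open>D\<close>, whence the strict inequality.\<close>

lemma total_dist_rotate_branches:
  assumes br: "branch v A" "branch v B" "branch v C"
    and disj: "A \<inter> B = {}" "B \<inter> C = {}" "C \<inter> A = {}"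
    and V: "V = insert v (A \<union> B \<union> C)"
    and a: "a \<in> A" "(a, v) \<in> R" and b: "b \<in> B" "(b, v) \<in> R" and c: "c \<in> C" "(c, v) \<in> R"
    and D: "D \<subseteq> V \<times> V" "(v, u) \<in> D" "u \<noteq> v"
  shows "3 * total_dist D R
    < total_dist D (reattach v A b) + total_dist D (reattach v B c) + total_dist D (reattach v C a)"
proof -
  let ?d1 = "step_dist (reattach v A b)" and ?d2 = "step_dist (reattach v B c)"
    and ?d3 = "step_dist (reattach v C a)"
  have notin: "v \<notin> A" "v \<notin> B" "v \<notin> C" using br by (auto simp: branch_def)
  have pointwise: "3 * d x y + (if (x = v) = (y = v) then 0 else 1)
      \<le> ?d1 x y + ?d2 x y + ?d3 x y" if xy: "x \<in> V" "y \<in> V" for x y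
  proof -
    have part: "z = v \<and> z \<notin> A \<and> z \<notin> B \<and> z \<notin> C \<or> z \<noteq> v \<and> z \<in> A \<and> z \<notin> B \<and> z \<notin> C
        \<or> z \<noteq> v \<and> z \<notin> A \<and> z \<in> B \<and> z \<notin> C \<or> z \<noteq> v \<and> z \<notin> A \<and> z \<notin> B \<and> z \<in> C" if "z \<in> V" for z
      using that V notin disj by blast
    have "3 * int (d x y) + (if (x = v) = (y = v) then 0 else 1)
      \<le> int (?d1 x y) + int (?d2 x y) + int (?d3 x y)"
      using part[OF xy(1)] part[OF xy(2)]
        d_reattach_ge[OF br(1,2) disj(1) b xy] d_reattach_ge[OF br(2,3) disj(2) c xy]
        d_reattach_ge[OF br(3,1) disj(3) a xy]
      by (elim disjE conjE) simp_all
    then show ?thesis by (auto split: if_splits)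
  qed
  have fin: "finite D" using D(1) finite_V by (meson finite_SigmaI finite_subset)
  have "(\<Sum>(x, y)\<in>D. 3 * d x y) < (\<Sum>(x, y)\<in>D. ?d1 x y + ?d2 x y + ?d3 x y)"
  proof (rule sum_strict_mono_ex1[OF fin])
    show "\<forall>p\<in>D. (case p of (x, y) \<Rightarrow> 3 * d x y) \<le> (case p of (x, y) \<Rightarrow> ?d1 x y + ?d2 x y + ?d3 x y)"
      using pointwise D(1) by (fastforce split: if_splits)
    show "\<exists>p\<in>D. (case p of (x, y) \<Rightarrow> 3 * d x y) < (case p of (x, y) \<Rightarrow> ?d1 x y + ?d2 x y + ?d3 x y)"
      using pointwise[of v u] D by (intro bexI[of _ "(v, u)"]) auto
  qed
  then show ?thesis
    unfolding total_dist_def by (simp add: case_prod_unfold sum.distrib sum_distrib_left)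
qed

text \<open>Follow predecessors towards \<open>v\<close> along shortest walks; \<open>r x\<close> is the neighbour of \<open>v\<close> through which \<open>x\<close> is
reached. Edges between vertices with different \<open>r\<close> can be deleted, as a vertex and its predecessor have the
same \<open>r\<close>.\<close>

lemma split_into_branches:
  assumes "v \<in> V"
  obtains T r where "conn_graph V T" "T \<subseteq> R"
    and "\<And>x. (v, x) \<in> R \<Longrightarrow> (v, x) \<in> T \<and> r x = x"
    and "\<And>x y. (x, y) \<in> T \<Longrightarrow> x \<noteq> v \<Longrightarrow> y \<noteq> v \<Longrightarrow> r x = r y"
proof -
  have "\<exists>p. (p, x) \<in> R \<and> Suc (d v p) = d v x" if x: "x \<in> V" "x \<noteq> v" for x
  proof (cases "d v x")
    case 0
    then show ?thesis using d_eq_0[OF assms x(1)] x(2) by simp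
  next
    case (Suc k)
    from predecessor[OF assms x(1) this] obtain q where "(q, x) \<in> R" "d v q = k" by blast
    with Suc show ?thesis by auto
  qed
  then have "\<forall>x\<in>V - {v}. \<exists>p. (p, x) \<in> R \<and> Suc (d v p) = d v x" by blast
  then obtain p where "\<forall>x\<in>V - {v}. (p x, x) \<in> R \<and> Suc (d v (p x)) = d v x"
    by (rule bchoice[THEN exE])
  then have p: "(p x, x) \<in> R" "Suc (d v (p x)) = d v x" if "x \<in> V" "x \<noteq> v" for x
    using that by auto
  \<comment> \<open>The last vertex before \<open>v\<close> when the predecessor map is iterated from \<open>x\<close>.\<close>
  define r where "r x = (p ^^ (d v x - 1)) x" for x
  define T where "T = {(x, y) \<in> R. x = v \<or> y = v \<or> r x = r y}"
  have r1: "r x = x" if "(v, x) \<in> R" for x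
    using d_edge[OF that] by (simp add: r_def)
  have rp: "r (p x) = r x" if x: "x \<in> V" "x \<noteq> v" "p x \<noteq> v" for x
  proof -
    have "d v (p x) \<noteq> 0" using d_eq_0[of v "p x"] assms edge_V[OF p(1)[OF x(1,2)]] x(3) by auto
    then obtain k where k: "d v (p x) = Suc k" by (cases "d v (p x)") auto
    then have "d v x = Suc (Suc k)" using p(2)[OF x(1,2)] by simp
    with k show ?thesis by (simp add: r_def funpow_swap1)
  qed
  have reach: "(v, x) \<in> T\<^sup>*" if "x \<in> V" for x
    using that
  proof (induction "d v x" arbitrary: x rule: less_induct)
    case less
    show ?case
    proof (cases "x = v")
      case False
      note px = p[OF less.prems False]
      have "(v, p x) \<in> T\<^sup>*"
        using less.hyps[of "p x"] px edge_V[OF px(1)] by simp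
      moreover have "(p x, x) \<in> T" using px rp[OF less.prems False] by (auto simp: T_def)
      ultimately show ?thesis by (rule rtrancl_into_rtrancl)
    qed auto
  qed
  have "conn_graph V T"
  proof (rule conn_graphI[where v = v])
    show "(y, x) \<in> T" if "(x, y) \<in> T" for x y using that R_sym[of x y] by (auto simp: T_def)
    show "(v, x) \<in> T\<^sup>*" if "x \<in> V" for x using reach[OF that] .
    show "T \<subseteq> V \<times> V" "(x, x) \<notin> T" for x using R_sub R_irrefl by (auto simp: T_def)
  qed (rule finite_V)
  moreover have "T \<subseteq> R" by (auto simp: T_def)
  moreover have "(v, x) \<in> T \<and> r x = x" if "(v, x) \<in> R" for x
    using that r1[OF that] by (simp add: T_def)
  moreover have "r x = r y" if "(x, y) \<in> T" "x \<noteq> v" "y \<noteq> v" for x y using that by (auto simp: T_def)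
  ultimately show ?thesis by (rule that)
qed

end

section \<open>Graphs of maximal total distance\<close>

locale maximal_graph = conn_graph +
  fixes D :: "('a \<times> 'a) set"
  assumes D: "conn_graph V D"
    and maximal: "conn_graph V R' \<Longrightarrow> total_dist D R' \<le> total_dist D R"
begin

lemma D_sub: "D \<subseteq> V \<times> V"
  using D by (rule conn_graph.R_sub)

lemma D_neighbour:
  assumes "v \<in> V" "w \<in> V" "w \<noteq> v"
  obtains u where "(v, u) \<in> D" "u \<noteq> v"
proof -
  have "(v, w) \<in> D\<^sup>*" using conn_graph.R_conn[OF D assms(1,2)] .
  then obtain u where "(v, u) \<in> D" using assms(3) by (blast elim: converse_rtranclE)
  with that conn_graph.R_irrefl[OF D, of v] show ?thesis by blast
qed

lemma maximal_subgraph: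
  assumes "conn_graph V T" "T \<subseteq> R"
  shows "maximal_graph V T D"
proof -
  have "total_dist D R \<le> total_dist D T"
    using total_dist_antimono[OF assms D_sub] .
  then show ?thesis
    using assms(1) D maximal unfolding maximal_graph_def maximal_graph_axioms_def
    by (meson le_trans)
qed

text \<open>The distances in the subgraph are at least those in \<open>R\<close>, so a single longer distance along \<open>D\<close> would make the
subgraph better than \<open>R\<close>.\<close>

lemma dist_subgraph_eq:
  assumes "conn_graph V T" "T \<subseteq> R" "(x, y) \<in> D"
  shows "step_dist T x y = d x y"
proof (rule ccontr)
  assume neq: "step_dist T x y \<noteq> d x y"
  have le: "d x y \<le> step_dist T x y" if "(x, y) \<in> D" for x y
    using that D_sub by (intro step_dist_antimono[OF assms(1,2)]) auto
  have "total_dist D R < total_dist D T"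
    unfolding total_dist_def
  proof (rule sum_strict_mono_ex1)
    show "finite D" using D_sub finite_V by (meson finite_SigmaI finite_subset)
    show "\<forall>p\<in>D. (case p of (x, y) \<Rightarrow> d x y) \<le> (case p of (x, y) \<Rightarrow> step_dist T x y)"
      using le by auto
    show "\<exists>p\<in>D. (case p of (x, y) \<Rightarrow> d x y) < (case p of (x, y) \<Rightarrow> step_dist T x y)"
      using le[OF assms(3)] neq assms(3) by (intro bexI[of _ "(x, y)"]) auto
  qed
  with maximal[OF assms(1)] show False by simp
qed

lemma not_three_branches:
  assumes br: "branch v A" "branch v B" "branch v C"
    and disj: "A \<inter> B = {}" "B \<inter> C = {}" "C \<inter> A = {}"
    and V: "V = insert v (A \<union> B \<union> C)"
    and a: "a \<in> A" "(a, v) \<in> R" and b: "b \<in> B" "(b, v) \<in> R" and c: "c \<in> C" "(c, v) \<in> R"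
  shows False
proof -
  have notin: "b \<notin> A" "c \<notin> B" "a \<notin> C" using a b c disj by auto
  have "v \<in> V" "a \<in> V" "a \<noteq> v" using a V R_irrefl by auto
  then obtain u where "(v, u) \<in> D" "u \<noteq> v" using D_neighbour by blast
  from total_dist_rotate_branches[OF br disj V a b c D_sub this] show False
    using maximal[OF conn_graph_reattach[OF br(1) b(2) notin(1)]]
      maximal[OF conn_graph_reattach[OF br(2) c(2) notin(2)]]
      maximal[OF conn_graph_reattach[OF br(3) a(2) notin(3)]]
    by linarith
qed

text \<open>With three neighbours \<open>a\<close>, \<open>b\<close>, \<open>c\<close> of \<open>v\<close>, the vertices reached through \<open>a\<close>, those reached through \<open>b\<close> and the
remaining ones are branches of a spanning subgraph.\<close>

lemma degree_le_2:
  assumes "(v, a) \<in> R" "(v, b) \<in> R" "(v, c) \<in> R"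
  shows "a = b \<or> a = c \<or> b = c"
proof (rule ccontr)
  assume distinct: "\<not> (a = b \<or> a = c \<or> b = c)"
  have "v \<in> V" using edge_V[OF assms(1)] by auto
  then obtain T r where T: "conn_graph V T" "T \<subseteq> R"
    and nb: "\<And>x. (v, x) \<in> R \<Longrightarrow> (v, x) \<in> T \<and> r x = x"
    and same: "\<And>x y. (x, y) \<in> T \<Longrightarrow> x \<noteq> v \<Longrightarrow> y \<noteq> v \<Longrightarrow> r x = r y"
    by (rule split_into_branches) blast
  interpret T: maximal_graph V T D by (rule maximal_subgraph[OF T])
  have neq: "a \<noteq> v" "b \<noteq> v" "c \<noteq> v" using assms R_irrefl by auto
  define A B C where "A = {x \<in> V - {v}. r x = a}" and "B = {x \<in> V - {v}. r x = b}"
    and "C = {x \<in> V - {v}. r x \<noteq> a \<and> r x \<noteq> b}"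
  have br: "T.branch v {x \<in> V - {v}. P (r x)}" for P
    unfolding T.branch_def
  proof (intro conjI ballI allI impI)
    fix x y assume "x \<in> {x \<in> V - {v}. P (r x)}" "(x, y) \<in> T"
    then show "y \<in> {x \<in> V - {v}. P (r x)} \<or> y = v"
      using same[of x y] T.edge_V[of x y] by auto
  qed auto
  show False
  proof (rule T.not_three_branches)
    show "T.branch v A" "T.branch v B" "T.branch v C"
      unfolding A_def B_def C_def
      using br[of "\<lambda>z. z = a"] br[of "\<lambda>z. z = b"] br[of "\<lambda>z. z \<noteq> a \<and> z \<noteq> b"] by auto
    show "a \<in> A" "b \<in> B" "c \<in> C"
      using nb assms distinct neq edge_V by (auto simp: A_def B_def C_def)
    show "(a, v) \<in> T" "(b, v) \<in> T" "(c, v) \<in> T" 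
      using nb[OF assms(1)] nb[OF assms(2)] nb[OF assms(3)] T.R_sym[of v] by blast+
  qed (use distinct \<open>v \<in> V\<close> in \<open>auto simp: A_def B_def C_def\<close>)
qed

end


section \<open>Maximal graphs are paths\<close>

text \<open>The path that visits the vertices of \<open>V\<close> in the order of their positions \<open>\<pi>\<close>. The positions need not start
at 0, so that a rotation of a cycle is a shift of some of the positions.\<close>

definition linear :: "'a set \<Rightarrow> ('a \<Rightarrow> nat) \<Rightarrow> ('a \<times> 'a) set" where
  "linear V \<pi> = {(x, y) \<in> V \<times> V. \<pi> x = Suc (\<pi> y) \<or> \<pi> y = Suc (\<pi> x)}"

lemma linear_walk:
  assumes "bij_betw \<pi> V {m..<m + n}" "x \<in> V" "y \<in> V" "\<pi> y = \<pi> x + k"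
  shows "(x, y) \<in> linear V \<pi> ^^ k"
  using assms(3,4)
proof (induction k arbitrary: y)
  case 0
  then have "x = y" using bij_betw_imp_inj_on[OF assms(1)] assms(2) by (auto dest: inj_onD)
  then show ?case by simp
next
  case (Suc k)
  have "\<pi> x + k \<in> {m..<m + n}"
    using Suc.prems bij_betwE[OF assms(1)] assms(2) by fastforce
  then have "\<pi> x + k \<in> \<pi> ` V" using bij_betw_imp_surj_on[OF assms(1)] by simp
  then obtain w where w: "w \<in> V" "\<pi> w = \<pi> x + k" by (metis imageE)
  then have "(w, y) \<in> linear V \<pi>" using Suc.prems by (simp add: linear_def)
  with Suc.IH[OF w] show ?case by auto
qed

lemma conn_graph_linear:
  assumes "bij_betw \<pi> V {m..<m + n}"
  shows "conn_graph V (linear V \<pi>)"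
proof
  show "finite V" using assms bij_betw_finite by blast
  have sym: "(x, y) \<in> linear V \<pi> \<Longrightarrow> (y, x) \<in> linear V \<pi>" for x y by (auto simp: linear_def)
  then show "(x, y) \<in> linear V \<pi> \<Longrightarrow> (y, x) \<in> linear V \<pi>" for x y .
  have symc: "sym ((linear V \<pi>)\<^sup>*)" using sym by (intro sym_rtrancl symI)
  have le: "(x, y) \<in> (linear V \<pi>)\<^sup>*" if "x \<in> V" "y \<in> V" "\<pi> x \<le> \<pi> y" for x y
    using linear_walk[OF assms that(1,2), of "\<pi> y - \<pi> x"] that(3)
    by (simp add: relpow_imp_rtrancl)
  show "(x, y) \<in> (linear V \<pi>)\<^sup>*" if "x \<in> V" "y \<in> V" for x y
    using le[OF that] le[OF that(2,1)] symD[OF symc] by (cases "\<pi> x \<le> \<pi> y") auto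
qed (auto simp: linear_def)

lemma step_dist_linear:
  assumes "bij_betw \<pi> V {m..<m + n}" "x \<in> V" "y \<in> V" "\<pi> x \<le> \<pi> y"
  shows "step_dist (linear V \<pi>) x y = \<pi> y - \<pi> x"
proof (rule antisym)
  interpret conn_graph V "linear V \<pi>" by (rule conn_graph_linear[OF assms(1)])
  show "d x y \<le> \<pi> y - \<pi> x"
    using linear_walk[OF assms(1-3), of "\<pi> y - \<pi> x"] assms(4) by (intro step_dist_le) simp
  have "\<pi> y \<le> \<pi> x + d x y"
    by (rule d_ge_potential) (use assms in \<open>auto simp: linear_def\<close>)
  then show "\<pi> y - \<pi> x \<le> d x y" by simp
qed

lemma downward_closed_nat:
  fixes S :: "nat set"
  assumes "finite S" "\<And>k. Suc k \<in> S \<Longrightarrow> k \<in> S"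
  shows "S = {0..<card S}"
proof (cases "S = {}")
  case False
  define M where "M = Max S"
  have "M \<in> S" "\<And>k. k \<in> S \<Longrightarrow> k \<le> M" using assms(1) False by (auto simp: M_def)
  moreover have "j \<in> S" if "j \<le> M" for j
    using that by (rule inc_induct) (use \<open>M \<in> S\<close> assms(2) in auto)
  ultimately have "S = {0..<Suc M}" by fastforce
  then show ?thesis by (metis card_atLeastLessThan diff_zero)
qed simp

context conn_graph
begin

text \<open>The distances from the end \<open>z\<close> serve as positions. By induction, two different vertices at the same
distance from \<open>z\<close> have the same predecessor, which would then have at least two neighbours if it is \<open>z\<close>, and
three otherwise.\<close>

lemma linear_from_end:
  assumes deg: "\<forall>v a b c. (v, a) \<in> R \<longrightarrow> (v, b) \<in> R \<longrightarrow> (v, c) \<in> R \<longrightarrow> a = b \<or> a = c \<or> b = c"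
    and z: "z \<in> V" "\<forall>a b. (z, a) \<in> R \<longrightarrow> (z, b) \<in> R \<longrightarrow> a = b"
  shows "bij_betw (d z) V {0..<card V}" and "R = linear V (d z)"
proof -
  have level: "x = y" if "d z x = k" "d z y = k" "x \<in> V" "y \<in> V" for x y k
    using that
  proof (induction k arbitrary: x y rule: less_induct)
    case (less k)
    show ?case
    proof (cases k)
      case 0
      then show ?thesis using less.prems d_eq_0[OF z(1)] by auto
    next
      case (Suc j)
      obtain a where a: "(a, x) \<in> R" "d z a = j"
        using predecessor[OF z(1) less.prems(3)] less.prems(1) Suc by blast
      obtain b where b: "(b, y) \<in> R" "d z b = j"
        using predecessor[OF z(1) less.prems(4)] less.prems(2) Suc by blast
      have ab: "a = b" using less.IH[of j a b] a b Suc edge_V by blast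
      show ?thesis
      proof (cases j)
        case 0
        then have "a = z" using d_eq_0[OF z(1), of a] a edge_V by auto
        then show ?thesis using z(2) a b ab by blast
      next
        case (Suc i)
        obtain c where c: "(c, a) \<in> R" "d z c = i"
          using predecessor[OF z(1), of a i] a edge_V Suc by blast
        have "c \<noteq> x" "c \<noteq> y" using c less.prems \<open>k = Suc j\<close> Suc by auto
        then show ?thesis using deg R_sym[OF c(1)] a(1) b(1) ab by blast
      qed
    qed
  qed
  then have inj: "inj_on (d z) V" by (auto intro: inj_onI)
  have "d z ` V = {0..<card (d z ` V)}"
  proof (rule downward_closed_nat)
    show "finite (d z ` V)" using finite_V by simp
    fix k assume "Suc k \<in> d z ` V"
    then obtain y where "y \<in> V" "d z y = Suc k" by auto
    with predecessor[OF z(1)] obtain p where "(p, y) \<in> R" "d z p = k" by metis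
    then show "k \<in> d z ` V" using edge_V by blast
  qed
  then show "bij_betw (d z) V {0..<card V}"
    using inj by (simp add: bij_betw_def card_image)
  show "R = linear V (d z)"
  proof (intro equalityI subrelI)
    fix x y assume xy: "(x, y) \<in> R"
    then have V: "x \<in> V" "y \<in> V" using edge_V by auto
    have "d z x \<noteq> d z y" using level[OF _ refl V] xy R_irrefl by auto
    then show "(x, y) \<in> linear V (d z)"
      using d_edge_le[OF z(1) xy] d_edge_le[OF z(1) R_sym[OF xy]] V by (auto simp: linear_def)
  next
    have up: "(x, y) \<in> R" if up: "x \<in> V" "y \<in> V" "d z y = Suc (d z x)" for x y
    proof -
      obtain p where p: "(p, y) \<in> R" "d z p = d z x" using predecessor[OF z(1) up(2,3)] by blast
      then have "p = x" using level[OF p(2) refl] edge_V p(1) up(1) by blast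
      with p show ?thesis by simp
    qed
    fix x y assume "(x, y) \<in> linear V (d z)"
    then show "(x, y) \<in> R" using up[of x y] up[of y x] R_sym[of y x] by (auto simp: linear_def)
  qed
qed

text \<open>Shortest walks from \<open>v\<close> to other vertices avoid a farthest vertex \<open>z\<close>, so an edge at \<open>z\<close> can be deleted as long
as an edge to a predecessor remains.\<close>

lemma remove_edge_at_farthest:
  assumes v: "v \<in> V" and z: "z \<in> V" "\<And>x. x \<in> V \<Longrightarrow> d v x \<le> d v z"
    and p: "(p, z) \<in> R" "d v z = Suc (d v p)" and q: "q \<noteq> p"
  shows "conn_graph V (R - {(z, q), (q, z)})"
proof (rule conn_graphI[where v = v])
  let ?T = "R - {(z, q), (q, z)}"
  show "(v, x) \<in> ?T\<^sup>*" if "x \<in> V" for x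
    using that
  proof (induction "d v x" arbitrary: x)
    case 0
    then show ?case using d_eq_0[OF v] by simp
  next
    case (Suc k)
    obtain a where a: "(a, x) \<in> ?T" "d v a = k"
    proof (cases "x = z")
      case True
      then show ?thesis using that[of p] p q Suc.hyps R_irrefl by auto
    next
      case False
      obtain a where a: "(a, x) \<in> R" "d v a = k"
        using predecessor[OF v Suc.prems] Suc.hyps by metis
      then have "a \<noteq> z" using z(2)[OF Suc.prems] Suc.hyps by auto
      with a False that[of a] show ?thesis by auto
    qed
    moreover have "(v, a) \<in> ?T\<^sup>*" using Suc.hyps(1)[of a] a edge_V by auto
    ultimately show ?case by (meson rtrancl_into_rtrancl)
  qed
  show "(y, x) \<in> ?T" if "(x, y) \<in> ?T" for x y using that R_sym[of x y] by auto
qed (use finite_V R_sub R_irrefl in auto)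

end

context maximal_graph
begin

text \<open>For \<open>D\<close>-neighbours \<open>x\<close> and \<open>y\<close>, cutting the cycle between \<open>q\<close> and \<open>z\<close> and cutting it between \<open>x\<close> and its
successor give two spanning paths in which \<open>x\<close> and \<open>y\<close> are joined by complementary arcs of the cycle. Both paths
have the distances of \<open>R\<close> along \<open>D\<close>, so the two arcs have the same length.\<close>

lemma not_cycle:
  assumes bij: "bij_betw \<pi> V {0..<card V}" and card: "card V \<ge> 3"
    and sub: "linear V \<pi> \<subseteq> R"
    and zq: "z \<in> V" "q \<in> V" "\<pi> z = 0" "Suc (\<pi> q) = card V" "(z, q) \<in> R"
  shows False
proof -
  let ?n = "card V"
  have inj: "inj_on \<pi> V" and img: "\<pi> ` V = {0..<?n}" using bij by (auto simp: bij_betw_def)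
  have less_n: "\<pi> x < ?n" if "x \<in> V" for x using img that by auto
  have lt: "2 * (\<pi> y - \<pi> x) = ?n" if xy: "(x, y) \<in> D" "\<pi> x < \<pi> y" for x y
  proof -
    have V: "x \<in> V" "y \<in> V" using D_sub xy by auto
    have bij0: "bij_betw \<pi> V {0..<0 + ?n}" using bij by simp
    have "d x y = \<pi> y - \<pi> x"
      using dist_subgraph_eq[OF conn_graph_linear[OF bij0] sub xy(1)]
        step_dist_linear[OF bij0 V] xy(2) by simp
    \<comment> \<open>The path obtained by removing the edge of the cycle that follows \<open>x\<close>: it runs from the successor of \<open>x\<close>
      up to \<open>q\<close>, then from \<open>z\<close> to \<open>x\<close>.\<close>
    define \<phi> where "\<phi> u = (if \<pi> u \<le> \<pi> x then \<pi> u + ?n else \<pi> u)" for u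
    have "inj_on \<phi> V"
      using inj less_n by (fastforce simp: inj_on_def \<phi>_def split: if_splits)
    moreover have "\<phi> ` V \<subseteq> {Suc (\<pi> x)..<Suc (\<pi> x) + ?n}"
      using less_n less_n[OF V(1)] by (fastforce simp: \<phi>_def)
    ultimately have "\<phi> ` V = {Suc (\<pi> x)..<Suc (\<pi> x) + ?n}"
      by (intro card_subset_eq) (simp_all add: card_image)
    with \<open>inj_on \<phi> V\<close> have bij': "bij_betw \<phi> V {Suc (\<pi> x)..<Suc (\<pi> x) + ?n}"
      by (simp add: bij_betw_def)
    have up: "(u, w) \<in> R" if uw: "u \<in> V" "w \<in> V" "\<phi> u = Suc (\<phi> w)" for u w
    proof (cases "\<pi> u = Suc (\<pi> w)")
      case True
      then show ?thesis using uw sub by (auto simp: linear_def)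
    next
      case False
      then have "\<pi> u = \<pi> z" "\<pi> w = \<pi> q"
        using uw less_n[OF uw(1)] less_n[OF uw(2)] zq(3,4) by (auto simp: \<phi>_def split: if_splits)
      then have "u = z" "w = q" using inj_on_eq_iff[OF inj] uw(1,2) zq(1,2) by blast+
      then show ?thesis using zq(5) by simp
    qed
    have sub': "linear V \<phi> \<subseteq> R"
    proof (rule subrelI)
      fix u w assume "(u, w) \<in> linear V \<phi>"
      then show "(u, w) \<in> R" using up[of u w] up[of w u] R_sym[of w u] by (auto simp: linear_def)
    qed
    have \<phi>xy: "\<phi> x = \<pi> x + ?n" "\<phi> y = \<pi> y" using xy(2) by (auto simp: \<phi>_def)
    have "d x y = step_dist (linear V \<phi>) x y"
      using dist_subgraph_eq[OF conn_graph_linear[OF bij'] sub' xy(1)] by simp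
    also have "\<dots> = step_dist (linear V \<phi>) y x"
      using conn_graph.d_commute[OF conn_graph_linear[OF bij'] V] .
    also have "\<dots> = \<pi> x + ?n - \<pi> y"
      using step_dist_linear[OF bij' V(2,1)] \<phi>xy less_n[OF V(2)] by simp
    finally show ?thesis using \<open>d x y = \<pi> y - \<pi> x\<close> xy(2) less_n[OF V(2)] by simp
  qed
  have antipodal: "2 * (\<pi> y - \<pi> x) = ?n \<or> 2 * (\<pi> x - \<pi> y) = ?n" if xy: "(x, y) \<in> D" for x y
  proof -
    have "x \<in> V" "y \<in> V" using D_sub xy by auto
    moreover have "x \<noteq> y" using xy conn_graph.R_irrefl[OF D] by auto
    ultimately have "\<pi> x \<noteq> \<pi> y" using inj_on_eq_iff[OF inj] by blast
    then show ?thesis using lt[OF xy] lt[OF conn_graph.R_sym[OF D xy]] by linarith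
  qed
  have "z \<noteq> q" using zq card by auto
  then obtain y where zy: "(z, y) \<in> D" using D_neighbour[OF zq(1,2)] by blast
  then have y: "y \<in> V" "2 * \<pi> y = ?n" using antipodal[OF zy] zq(3) D_sub card by auto
  have "D `` {z, y} \<subseteq> {z, y}"
  proof
    fix x assume "x \<in> D `` {z, y}"
    then consider "(z, x) \<in> D" | "(y, x) \<in> D" by auto
    then have "x \<in> V \<and> (\<pi> x = \<pi> y \<or> \<pi> x = \<pi> z)"
    proof cases
      case 1
      then show ?thesis using antipodal[OF 1] zq(3) y D_sub card by auto
    next
      case 2
      then have "x \<in> V" using D_sub by auto
      then show ?thesis using antipodal[OF 2] zq(3) y less_n[of x] by auto
    qed
    then show "x \<in> {z, y}" using inj_on_eq_iff[OF inj] y(1) zq(1) by blast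
  qed
  then have "D\<^sup>* `` {z, y} = {z, y}" by (rule Image_closed_trancl)
  moreover have "V \<subseteq> D\<^sup>* `` {z, y}" using conn_graph.R_conn[OF D zq(1)] by auto
  ultimately have "card V \<le> card {z, y}" by (simp add: card_mono)
  also have "\<dots> \<le> 2" by (simp add: card_insert_if)
  finally show False using card by simp
qed

text \<open>Take a vertex \<open>z\<close> at greatest distance from some vertex. If it has a second neighbour \<open>q\<close>, then \<open>R\<close> without the edge
from \<open>z\<close> to \<open>q\<close> is still connected and is a path with end \<open>z\<close>. Its other end is \<open>q\<close>, because an inner vertex
\<open>q\<close> would have three neighbours in \<open>R\<close>. So \<open>R\<close> would be a cycle.\<close>

theorem maximal_imp_linear:
  assumes "V \<noteq> {}"
  obtains \<pi> where "bij_betw \<pi> V {0..<card V}" "R = linear V \<pi>"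
proof -
  obtain v where v: "v \<in> V" using assms by auto
  have "Max (d v ` V) \<in> d v ` V" using finite_V assms by simp
  then obtain z where "z \<in> V" "Max (d v ` V) = d v z" by blast
  then have z: "z \<in> V" "\<And>x. x \<in> V \<Longrightarrow> d v x \<le> d v z"
    using Max_ge[of "d v ` V"] finite_V by auto
  show ?thesis
  proof (cases "\<forall>a b. (z, a) \<in> R \<longrightarrow> (z, b) \<in> R \<longrightarrow> a = b")
    case True
    have deg: "\<forall>v a b c. (v, a) \<in> R \<longrightarrow> (v, b) \<in> R \<longrightarrow> (v, c) \<in> R \<longrightarrow> a = b \<or> a = c \<or> b = c"
      using degree_le_2 by blast
    show ?thesis by (rule that[OF linear_from_end[OF deg z(1) True]])
  next
    case False
    then obtain a b where ab: "(z, a) \<in> R" "(z, b) \<in> R" "a \<noteq> b" by auto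
    have "z \<noteq> v"
    proof
      assume "z = v"
      then have "d v a = 0" using z(2)[of a] edge_V[OF ab(1)] by simp
      then have "v = a" using d_eq_0[OF v, of a] edge_V[OF ab(1)] by auto
      then show False using ab(1) \<open>z = v\<close> R_irrefl by auto
    qed
    then obtain k where "d v z = Suc k" using d_eq_0[OF v z(1)] by (cases "d v z") auto
    from predecessor[OF v z(1) this] obtain p where "(p, z) \<in> R" "d v p = k" by blast
    with \<open>d v z = Suc k\<close> have p: "(p, z) \<in> R" "d v z = Suc (d v p)" by simp_all
    obtain q where q: "(z, q) \<in> R" "q \<noteq> p" using ab by blast
    define T where "T = R - {(z, q), (q, z)}"
    have T: "conn_graph V T" "T \<subseteq> R"
      using remove_edge_at_farthest[OF v z p q(2)] by (auto simp: T_def)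
    interpret T: maximal_graph V T D by (rule maximal_subgraph[OF T])
    have zend: "\<forall>a b. (z, a) \<in> T \<longrightarrow> (z, b) \<in> T \<longrightarrow> a = b"
      using degree_le_2[OF R_sym[OF p(1)] q(1)] q(2) unfolding T_def by blast
    have Tdeg: "\<forall>v a b c. (v, a) \<in> T \<longrightarrow> (v, b) \<in> T \<longrightarrow> (v, c) \<in> T \<longrightarrow> a = b \<or> a = c \<or> b = c"
      using T.degree_le_2 by blast
    define \<pi> where "\<pi> = T.d z"
    have bij: "bij_betw \<pi> V {0..<card V}" and lin: "T = linear V \<pi>"
      using T.linear_from_end[OF Tdeg z(1) zend] by (auto simp: \<pi>_def)
    have V: "p \<in> V" "q \<in> V" using edge_V[OF p(1)] edge_V[OF q(1)] by auto
    have "z \<noteq> p" "z \<noteq> q" using p q R_irrefl by auto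
    then have "card {z, p, q} = 3" using q(2) by simp
    then have card: "card V \<ge> 3" using card_mono[OF finite_V, of "{z, p, q}"] z(1) V by simp
    have "Suc (\<pi> q) = card V"
    proof (rule ccontr)
      assume "Suc (\<pi> q) \<noteq> card V"
      moreover have "\<pi> q < card V" using bij V by (auto dest: bij_betwE)
      ultimately have "Suc (\<pi> q) \<in> \<pi> ` V" using bij_betw_imp_surj_on[OF bij] by auto
      then obtain s where s: "s \<in> V" "\<pi> s = Suc (\<pi> q)" by auto
      have "\<pi> q \<noteq> 0" using T.d_eq_0[OF z(1) V(2)] \<open>z \<noteq> q\<close> by (simp add: \<pi>_def)
      then have "\<pi> q - 1 \<in> \<pi> ` V" using bij_betw_imp_surj_on[OF bij] \<open>\<pi> q < card V\<close> by auto
      then obtain r where r: "r \<in> V" "Suc (\<pi> r) = \<pi> q" using \<open>\<pi> q \<noteq> 0\<close> by auto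
      have "(q, s) \<in> T" "(q, r) \<in> T" using s r V by (auto simp: lin linear_def)
      moreover from this have "s \<noteq> z" "r \<noteq> z" by (auto simp: T_def)
      moreover have "s \<noteq> r" using s r by auto
      ultimately show False
        using degree_le_2[OF R_sym[OF q(1)], of s r] T(2) by auto
    qed
    moreover have "linear V \<pi> \<subseteq> R" using T(2) unfolding lin .
    moreover have "\<pi> z = 0" by (simp add: \<pi>_def)
    ultimately have False using not_cycle[OF bij card _ z(1) V(2) _ _ q(1)] by blast
    then show ?thesis ..
  qed
qed

end


lemma ex_linear_dominating:
  assumes D: "conn_graph V D" and R: "conn_graph V R" and "V \<noteq> {}"
  obtains \<pi> where "bij_betw \<pi> V {0..<card V}" "total_dist D R \<le> total_dist D (linear V \<pi>)"
    and "total_dist D R = total_dist D (linear V \<pi>)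
      \<Longrightarrow> \<exists>\<sigma>. bij_betw \<sigma> V {0..<card V} \<and> R = linear V \<sigma>"
proof -
  let ?M = "{T. conn_graph V T}"
  have "?M \<subseteq> Pow (V \<times> V)" by (auto simp: conn_graph_def)
  moreover have "finite V" using R by (rule conn_graph.finite_V)
  ultimately have fin: "finite ?M" by (meson finite_Pow_iff finite_SigmaI finite_subset)
  then have "Max (total_dist D ` ?M) \<in> total_dist D ` ?M" using R by (intro Max_in) auto
  then obtain M where M: "conn_graph V M" "Max (total_dist D ` ?M) = total_dist D M" by blast
  have le: "total_dist D T \<le> total_dist D M" if "conn_graph V T" for T
    using Max_ge[of "total_dist D ` ?M" "total_dist D T"] fin that M(2) by simp
  have lin: "\<exists>\<sigma>. bij_betw \<sigma> V {0..<card V} \<and> T = linear V \<sigma>"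
    if T: "conn_graph V T" "total_dist D T = total_dist D M" for T
  proof -
    interpret maximal_graph V T D
      using T D le by (simp add: maximal_graph_def maximal_graph_axioms_def)
    show ?thesis using maximal_imp_linear[OF assms(3)] by blast
  qed
  from lin[OF M(1) refl] obtain \<pi> where "bij_betw \<pi> V {0..<card V}" "M = linear V \<pi>" by blast
  with le[OF R] lin[OF R] that[of \<pi>] show ?thesis by blast
qed

section \<open>Pseudoorderings as graphs on the vertices of H\<close>

definition pullback :: "'b set \<Rightarrow> ('b \<Rightarrow> 'a) \<Rightarrow> ('a \<times> 'a) set \<Rightarrow> ('b \<times> 'b) set" where
  "pullback V f R = {(x, y) \<in> V \<times> V. (f x, f y) \<in> R}"

lemma pullback_comp: "g ` U \<subseteq> V \<Longrightarrow> pullback U g (pullback V f R) = pullback U (f \<circ> g) R"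
  by (auto simp: pullback_def)

lemma relpow_pullback:
  assumes f: "bij_betw f V W" and R: "R \<subseteq> W \<times> W" and "x \<in> V" "y \<in> V"
  shows "(x, y) \<in> pullback V f R ^^ k \<longleftrightarrow> (f x, f y) \<in> R ^^ k"
  using \<open>y \<in> V\<close>
proof (induction k arbitrary: y)
  case 0
  then show ?case using inj_on_eq_iff[OF bij_betw_imp_inj_on[OF f]] \<open>x \<in> V\<close> by auto
next
  case (Suc k)
  have "(\<exists>w. (x, w) \<in> pullback V f R ^^ k \<and> (w, y) \<in> pullback V f R)
    \<longleftrightarrow> (\<exists>w\<in>V. (f x, f w) \<in> R ^^ k \<and> (f w, f y) \<in> R)"
    using Suc by (auto simp: pullback_def)
  also have "\<dots> \<longleftrightarrow> (\<exists>u\<in>W. (f x, u) \<in> R ^^ k \<and> (u, f y) \<in> R)"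
    unfolding bij_betw_imp_surj_on[OF f, symmetric] by simp
  also have "\<dots> \<longleftrightarrow> (\<exists>u. (f x, u) \<in> R ^^ k \<and> (u, f y) \<in> R)"
    using R by blast
  finally show ?case by (auto simp: relcomp_unfold)
qed

lemma step_dist_pullback:
  assumes "bij_betw f V W" "R \<subseteq> W \<times> W" "x \<in> V" "y \<in> V"
  shows "step_dist (pullback V f R) x y = step_dist R (f x) (f y)"
  by (simp add: step_dist_def relpow_pullback[OF assms])

lemma conn_graph_pullback:
  assumes f: "bij_betw f V W" and R: "conn_graph W R"
  shows "conn_graph V (pullback V f R)"
proof
  interpret R: conn_graph W R by fact
  show "finite V" using R.finite_V f bij_betw_finite by blast
  show "(x, y) \<in> (pullback V f R)\<^sup>*" if "x \<in> V" "y \<in> V" for x y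
    using relpow_pullback[OF f R.R_sub that] R.d_attained[of "f x" "f y"] bij_betwE[OF f] that
    by (meson relpow_imp_rtrancl)
qed (use conn_graph.R_sym[OF R] conn_graph.R_irrefl[OF R] in \<open>auto simp: pullback_def\<close>)

lemma conn_graph_parcs:
  assumes "pair_graph G" "connected (with_proj G)"
  shows "conn_graph (pverts G) (parcs G)"
proof
  interpret pair_graph G by fact
  show "finite (pverts G)" by (rule pair_finite_verts)
  show "parcs G \<subseteq> pverts G \<times> pverts G" using in_arcsD1 in_arcsD2 by auto
  show "(y, x) \<in> parcs G" if "(x, y) \<in> parcs G" for x y
    using that pair_sym_arcs by (auto simp: symmetric_def sym_def)
  show "(x, x) \<notin> parcs G" for x using no_loops' by blast
  have "strongly_connected (with_proj G)"
    using symmetric_connected_imp_strongly_connected pair_sym_arcs assms(2) by blast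
  then show "(x, y) \<in> (parcs G)\<^sup>*" if "x \<in> pverts G" "y \<in> pverts G" for x y
    using that reachable_rtranclI[of "with_proj G" x y] by (simp add: strongly_connected_def)
qed

lemma (in pair_graph) graph_dist_eq_step_dist:
  assumes "x \<in> pverts G"
  shows "graph_dist G x y = step_dist (parcs G) x y"
proof -
  have "(\<exists>p. awalk x p y \<and> length p = k) \<longleftrightarrow> (x, y) \<in> parcs G ^^ k" for k
    using assms
  proof (induction k arbitrary: x)
    case 0
    then show ?case by (auto simp: awalk_Nil_iff)
  next
    case (Suc k)
    have "(\<exists>p. awalk x p y \<and> length p = Suc k)
        \<longleftrightarrow> (\<exists>w. (x, w) \<in> parcs G \<and> (\<exists>p. awalk w p y \<and> length p = k))"
      (is "?L \<longleftrightarrow> ?R")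
    proof
      show "?L \<Longrightarrow> ?R" by (force simp: length_Suc_conv awalk_Cons_iff)
    next
      assume ?R
      then obtain w p where "(x, w) \<in> parcs G" "awalk w p y" "length p = k" by blast
      then show ?L
        using Suc.prems by (intro exI[of _ "(x, w) # p"]) (simp add: awalk_Cons_iff)
    qed
    also have "\<dots> \<longleftrightarrow> (\<exists>w. (x, w) \<in> parcs G \<and> (w, y) \<in> parcs G ^^ k)"
      using Suc.IH in_arcsD2 by blast
    also have "\<dots> \<longleftrightarrow> (x, y) \<in> parcs G ^^ Suc k"
      by (blast intro: relpow_Suc_I2 elim: relpow_Suc_E2)
    finally show ?case .
  qed
  then show ?thesis by (simp add: graph_dist_def step_dist_def)
qed

lemma (in pair_graph) sum_parcs_eq_twice_sum_edges:
  fixes w :: "'a set \<Rightarrow> nat"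
  shows "(\<Sum>(x, y)\<in>parcs G. w {x, y}) = 2 * (\<Sum>e\<in>edges G. w e)"
proof -
  let ?h = "\<lambda>a. {fst a, snd a}"
  have edges: "edges G = ?h ` parcs G" by (force simp: edges_def)
  have fibre: "card {a \<in> parcs G. ?h a = e} = 2" if "e \<in> edges G" for e
  proof -
    from that obtain x y where e: "e = {x, y}" "(x, y) \<in> parcs G" by (auto simp: edges_def)
    then have "(y, x) \<in> parcs G" "x \<noteq> y"
      using pair_sym_arcs no_loops' by (auto simp: symmetric_def sym_def)
    with e have "{a \<in> parcs G. ?h a = e} = {(x, y), (y, x)}"
      by (auto simp: doubleton_eq_iff)
    with \<open>x \<noteq> y\<close> show ?thesis by simp
  qed
  have "(\<Sum>(x, y)\<in>parcs G. w {x, y}) = (\<Sum>a\<in>parcs G. w (?h a))"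
    by (simp add: case_prod_unfold)
  also have "\<dots> = (\<Sum>e\<in>edges G. \<Sum>a\<in>{a \<in> parcs G. ?h a = e}. w (?h a))"
    unfolding edges by (rule sum.image_gen[OF pair_finite_arcs])
  also have "\<dots> = (\<Sum>e\<in>edges G. 2 * w e)"
    using fibre by (intro sum.cong) simp_all
  finally show ?thesis by (simp add: sum_distrib_left)
qed

lemma twice_pseudo_sum:
  assumes G: "pair_graph G" and H: "pair_graph H" and f: "pseudoordering H G f"
  shows "2 * pseudo_sum H f G = total_dist (parcs H) (pullback (pverts H) f (parcs G))"
proof -
  interpret G: pair_graph G by fact
  interpret H: pair_graph H by fact
  have bij: "bij_betw f (pverts H) (pverts G)" using f by (simp add: pseudoordering_def)
  have sub: "parcs G \<subseteq> pverts G \<times> pverts G" using G.in_arcsD1 G.in_arcsD2 by auto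
  have "2 * pseudo_sum H f G = (\<Sum>(x, y)\<in>parcs H. pair_dist G (f ` {x, y}))"
    unfolding pseudo_sum_def by (rule H.sum_parcs_eq_twice_sum_edges[symmetric])
  also have "\<dots> = (\<Sum>(x, y)\<in>parcs H. step_dist (pullback (pverts H) f (parcs G)) x y)"
  proof (intro sum.cong refl, clarify)
    fix x y assume "(x, y) \<in> parcs H"
    then have V: "x \<in> pverts H" "y \<in> pverts H" using H.in_arcsD1 H.in_arcsD2 by auto
    then show "pair_dist G (f ` {x, y}) = step_dist (pullback (pverts H) f (parcs G)) x y"
      using step_dist_pullback[OF bij sub V] G.graph_dist_eq_step_dist[of "f x" "f y"] bij_betwE[OF bij]
      by (simp add: G.pair_dist_doubleton)
  qed
  finally show ?thesis by (simp add: total_dist_def)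
qed

text \<open>There may be infinitely many pseudoorderings, as they are arbitrary outside the vertices of \<open>H\<close>. But the sum
depends only on the pullback of \<open>G\<close>, which leaves finitely many values for the maximum.\<close>

lemma
  assumes G: "pair_graph G" and H: "pair_graph H"
  shows pseudo_sum_le_upper_hamiltonian:
      "pseudoordering H G f \<Longrightarrow> pseudo_sum H f G \<le> upper_hamiltonian H G"
    and upper_hamiltonian_attained: "card (pverts G) = card (pverts H)
      \<Longrightarrow> \<exists>f. pseudoordering H G f \<and> upper_hamiltonian H G = pseudo_sum H f G"
proof -
  let ?S = "{pseudo_sum H f G | f. pseudoordering H G f}"
  let ?V = "pverts H"
  have fin: "finite (pverts G)" "finite ?V"
    using G H by (simp_all add: pair_graph_def pair_digraph_def pair_fin_digraph.pair_finite_verts)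
  have "?S \<subseteq> (\<lambda>R. total_dist (parcs H) R div 2) ` Pow (?V \<times> ?V)"
  proof clarify
    fix f assume "pseudoordering H G f"
    then have "pseudo_sum H f G = total_dist (parcs H) (pullback ?V f (parcs G)) div 2"
      using twice_pseudo_sum[OF G H, of f] by linarith
    moreover have "pullback ?V f (parcs G) \<in> Pow (?V \<times> ?V)" by (auto simp: pullback_def)
    ultimately show "pseudo_sum H f G \<in> (\<lambda>R. total_dist (parcs H) R div 2) ` Pow (?V \<times> ?V)"
      by blast
  qed
  then have finS: "finite ?S" using fin(2) by (meson finite_Pow_iff finite_SigmaI finite_imageI finite_subset)
  then show "pseudoordering H G f \<Longrightarrow> pseudo_sum H f G \<le> upper_hamiltonian H G"
    unfolding upper_hamiltonian_def by (intro Max_ge) auto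
  assume "card (pverts G) = card ?V"
  then obtain f where "bij_betw f ?V (pverts G)"
    using finite_same_card_bij[OF fin(2,1)] by auto
  then have "?S \<noteq> {}" by (auto simp: pseudoordering_def)
  from Max_in[OF finS this]
  show "\<exists>f. pseudoordering H G f \<and> upper_hamiltonian H G = pseudo_sum H f G"
    unfolding upper_hamiltonian_def by blast
qed

lemma digraph_iso_iff_pullback:
  assumes G: "pair_graph G" and P: "pair_graph P"
  shows "digraph_iso (with_proj G) (with_proj P) \<longleftrightarrow>
    (\<exists>h. bij_betw h (pverts G) (pverts P) \<and> parcs G = pullback (pverts G) h (parcs P))"
proof
  interpret G: pair_graph G by fact
  interpret P: pair_graph P by fact
  {
    assume "digraph_iso (with_proj G) (with_proj P)"
    then obtain hom where hom: "pre_digraph.digraph_isomorphism (with_proj G) hom"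
        "with_proj P = app_iso hom (with_proj G)"
      by (auto simp: digraph_iso_def)
    let ?h = "iso_verts hom"
    have verts: "pverts P = ?h ` pverts G" and arcs: "parcs P = iso_arcs hom ` parcs G"
      and ends: "iso_tail hom = fst" "iso_head hom = snd"
      using arg_cong[OF hom(2), of verts] arg_cong[OF hom(2), of arcs]
        arg_cong[OF hom(2), of tail] arg_cong[OF hom(2), of head] by simp_all
    have inj: "inj_on ?h (pverts G)"
      using hom(1) by (simp add: pre_digraph.digraph_isomorphism_def)
    have "iso_arcs hom a = (?h (fst a), ?h (snd a))" if "a \<in> parcs G" for a
      using hom(1) that by (auto simp: pre_digraph.digraph_isomorphism_def ends prod_eq_iff)
    then have arcs': "parcs P = (\<lambda>a. (?h (fst a), ?h (snd a))) ` parcs G"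
      unfolding arcs by (rule image_cong[OF refl])
    have "parcs G = pullback (pverts G) ?h (parcs P)"
    proof (intro equalityI subrelI)
      fix x y assume "(x, y) \<in> parcs G"
      then show "(x, y) \<in> pullback (pverts G) ?h (parcs P)"
        using G.in_arcsD1 G.in_arcsD2 by (force simp: pullback_def arcs')
    next
      fix x y assume "(x, y) \<in> pullback (pverts G) ?h (parcs P)"
      then obtain u w where "(u, w) \<in> parcs G" "?h x = ?h u" "?h y = ?h w" "x \<in> pverts G" "y \<in> pverts G"
        by (auto simp: pullback_def arcs')
      moreover from this have "x = u" "y = w"
        using inj_on_eq_iff[OF inj] G.in_arcsD1 G.in_arcsD2 by blast+
      ultimately show "(x, y) \<in> parcs G" by simp
    qed
    then show "\<exists>h. bij_betw h (pverts G) (pverts P) \<and> parcs G = pullback (pverts G) h (parcs P)"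
      using inj verts by (auto simp: bij_betw_def)
  }
  assume "\<exists>h. bij_betw h (pverts G) (pverts P) \<and> parcs G = pullback (pverts G) h (parcs P)"
  then obtain h where h: "inj_on h (pverts G)" "h ` pverts G = pverts P"
    and arcs: "parcs G = pullback (pverts G) h (parcs P)" by (auto simp: bij_betw_def)
  let ?hom = "\<lparr>iso_verts = h, iso_arcs = map_prod h h, iso_head = snd, iso_tail = fst\<rparr>"
  have "map_prod h h ` parcs G = parcs P"
  proof (intro equalityI subrelI)
    fix a b assume ab: "(a, b) \<in> parcs P"
    then obtain x y where "x \<in> pverts G" "y \<in> pverts G" "a = h x" "b = h y"
      using P.in_arcsD1[OF ab] P.in_arcsD2[OF ab] unfolding h(2)[symmetric] by blast
    with ab show "(a, b) \<in> map_prod h h ` parcs G"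
      by (auto simp: arcs pullback_def)
  qed (auto simp: arcs pullback_def)
  then have "with_proj P = app_iso ?hom (with_proj G)"
    using h(2) by (simp add: app_iso_def with_proj_def)
  moreover have "inj_on (map_prod h h) (parcs G)"
    using map_prod_inj_on[OF h(1) h(1)] G.in_arcsD1 G.in_arcsD2 by (auto elim: inj_on_subset)
  then have "pre_digraph.digraph_isomorphism (with_proj G) ?hom"
    using h(1) G.wf_digraph_axioms by (auto simp: pre_digraph.digraph_isomorphism_def)
  ultimately show "digraph_iso (with_proj G) (with_proj P)"
    unfolding digraph_iso_def by blast
qed

lemma pullback_path_graph:
  assumes "\<And>x. x \<in> V \<Longrightarrow> \<pi> x \<le> n"
  shows "pullback V \<pi> (parcs (path_graph n)) = linear V \<pi>"
  using assms by (auto simp: pullback_def path_graph_def linear_def)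

section \<open>The upper H-Hamiltonian number\<close>

theorem theorem3p7:
  fixes G :: "'a pair_pre_digraph" and H :: "'b pair_pre_digraph"
  assumes "pair_graph G" and "pair_graph H"
    and "connected (with_proj G)" and "connected (with_proj H)"
    and "card (pverts G) = card (pverts H)" and "card (pverts G) \<ge> 2"
  shows "upper_hamiltonian H G \<le> upper_hamiltonian H (path_graph (card (pverts G) - 1)) \<and>
    (upper_hamiltonian H G = upper_hamiltonian H (path_graph (card (pverts G) - 1)) \<longleftrightarrow>
      digraph_iso (with_proj G) (with_proj (path_graph (card (pverts G) - 1))))"
proof -
  let ?n = "card (pverts H)" and ?V = "pverts H" and ?D = "parcs H"
  define P where "P = path_graph (?n - 1)"
  note GH = assms(1,2)
  have P: "pair_graph P" unfolding P_def by (rule pair_graph_path_graph)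
  have vertsP: "pverts P = {0..<?n}" using assms(5,6) by (auto simp: P_def path_graph_def)
  have lin: "pullback ?V \<pi> (parcs P) = linear ?V \<pi>" if "bij_betw \<pi> ?V {0..<?n}" for \<pi>
    unfolding P_def using bij_betwE[OF that] by (intro pullback_path_graph) fastforce
  have D: "conn_graph ?V ?D" using assms(2,4) by (rule conn_graph_parcs)
  have "?V \<noteq> {}" using assms(5,6) by auto
  obtain f where f: "pseudoordering H G f" "upper_hamiltonian H G = pseudo_sum H f G"
    using upper_hamiltonian_attained[OF GH assms(5)] by blast
  then have bij_f: "bij_betw f ?V (pverts G)" by (simp add: pseudoordering_def)
  let ?R = "pullback ?V f (parcs G)"
  have R: "conn_graph ?V ?R"
    using conn_graph_pullback[OF bij_f conn_graph_parcs[OF assms(1,3)]] .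
  obtain \<pi> where bij: "bij_betw \<pi> ?V {0..<?n}" and le: "total_dist ?D ?R \<le> total_dist ?D (linear ?V \<pi>)"
    and eq: "total_dist ?D ?R = total_dist ?D (linear ?V \<pi>)
      \<Longrightarrow> \<exists>\<sigma>. bij_betw \<sigma> ?V {0..<?n} \<and> ?R = linear ?V \<sigma>"
    using ex_linear_dominating[OF D R \<open>?V \<noteq> {}\<close>] by blast
  have \<pi>: "pseudoordering H P \<pi>" using bij vertsP by (simp add: pseudoordering_def)
  have sums: "2 * pseudo_sum H f G = total_dist ?D ?R"
      "2 * pseudo_sum H \<pi> P = total_dist ?D (linear ?V \<pi>)"
    using twice_pseudo_sum[OF GH f(1)] twice_pseudo_sum[OF P GH(2) \<pi>] lin[OF bij] by simp_all
  have upper: "pseudo_sum H \<pi> P \<le> upper_hamiltonian H P"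
    by (rule pseudo_sum_le_upper_hamiltonian[OF P GH(2) \<pi>])
  have ineq: "upper_hamiltonian H G \<le> upper_hamiltonian H P"
    using sums le upper f(2) by linarith
  have "digraph_iso (with_proj G) (with_proj P)" if "upper_hamiltonian H G = upper_hamiltonian H P"
  proof -
    have "total_dist ?D ?R = total_dist ?D (linear ?V \<pi>)"
      using sums le upper f(2) that by linarith
    then obtain \<sigma> where \<sigma>: "bij_betw \<sigma> ?V {0..<?n}" "?R = linear ?V \<sigma>" using eq by blast
    \<comment> \<open>The pullback of \<open>G\<close> is a path on the vertices of \<open>H\<close>; transport it back to \<open>G\<close>.\<close>
    define g where "g = inv_into ?V f"
    have g: "bij_betw g (pverts G) ?V" unfolding g_def by (rule bij_betw_inv_into[OF bij_f])
    have fg: "f (g u) = u" if "u \<in> pverts G" for u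
      unfolding g_def using bij_f that by (metis bij_betw_imp_surj_on f_inv_into_f)
    have "parcs G \<subseteq> pverts G \<times> pverts G"
      using conn_graph.R_sub[OF conn_graph_parcs[OF assms(1,3)]] .
    then have "parcs G = pullback (pverts G) (f \<circ> g) (parcs G)"
      by (auto simp: pullback_def fg)
    also have "\<dots> = pullback (pverts G) g ?R"
      using bij_betw_imp_surj_on[OF g] by (simp add: pullback_comp)
    also have "\<dots> = pullback (pverts G) (\<sigma> \<circ> g) (parcs P)"
      unfolding \<sigma>(2) lin[OF \<sigma>(1), symmetric] using bij_betw_imp_surj_on[OF g] by (simp add: pullback_comp)
    finally show ?thesis
      unfolding digraph_iso_iff_pullback[OF assms(1) P] vertsP
      using bij_betw_trans[OF g \<sigma>(1)] by blast
  qed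
  moreover have "upper_hamiltonian H P \<le> upper_hamiltonian H G"
    if iso: "digraph_iso (with_proj G) (with_proj P)"
  proof -
    obtain h where h: "bij_betw h (pverts G) (pverts P)" "parcs G = pullback (pverts G) h (parcs P)"
      using iso unfolding digraph_iso_iff_pullback[OF assms(1) P] by blast
    have "card (pverts P) = ?n" by (simp add: vertsP)
    then obtain \<tau> where \<tau>: "pseudoordering H P \<tau>" "upper_hamiltonian H P = pseudo_sum H \<tau> P"
      using upper_hamiltonian_attained[OF P GH(2)] by blast
    \<comment> \<open>An isomorphism carries a best pseudoordering on the path to one on \<open>G\<close> with the same sum.\<close>
    define k where "k = inv_into (pverts G) h \<circ> \<tau>"
    have bij_\<tau>: "bij_betw \<tau> ?V (pverts P)" using \<tau>(1) by (simp add: pseudoordering_def)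
    then have bij_k: "bij_betw k ?V (pverts G)"
      unfolding k_def using bij_betw_inv_into[OF h(1)] by (rule bij_betw_trans)
    then have k: "pseudoordering H G k" by (simp add: pseudoordering_def)
    have hk: "(h \<circ> k) x = \<tau> x" if "x \<in> ?V" for x
      using bij_betwE[OF bij_\<tau>] that bij_betw_imp_surj_on[OF h(1)]
      by (simp add: k_def f_inv_into_f)
    have "pullback ?V k (parcs G) = pullback ?V (h \<circ> k) (parcs P)"
      using bij_betw_imp_surj_on[OF bij_k] by (subst h(2)) (simp add: pullback_comp)
    also have "\<dots> = pullback ?V \<tau> (parcs P)"
      using hk by (auto simp: pullback_def)
    finally have "pseudo_sum H k G = pseudo_sum H \<tau> P"
      using twice_pseudo_sum[OF GH k] twice_pseudo_sum[OF P GH(2) \<tau>(1)] by simp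
    then show ?thesis using pseudo_sum_le_upper_hamiltonian[OF GH k] \<tau>(2) by simp
  qed
  ultimately show ?thesis
    using ineq unfolding P_def assms(5) by (auto intro: antisym)
qed

end
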